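(* Let $k\ge 1$ be an integer, and let $(u_i)_{i\ge 0}$ be any sequence in $L^2(\Gamma,H;d\mu)$ produced by the following deflation algorithm: $u_0=0$ and, for $i=1,2,\dots$, $$u_i=u_{i-1}+s_i,\qquad s_i\in\Pi_k(e_{i-1}),\qquad e_{i-1}=u-u_{i-1}.$$ Then $u_i$ converges strongly to $u$ in $L^2(\Gamma,H;d\mu)$ as $i\to\infty$.
   Context: Setting: $H$ is a separable real Hilbert space with norm $\|\cdot\|$, and $H'$ is its dual, with duality pairing $\langle\cdot,\cdot\rangle$. $B_s(H)$ is the space of continuous symmetric bilinear forms on $H$ (with its usual norm). $(\Gamma,\mathcal B,\mu)$ is a $\sigma$-finite measure space. $a\in L^\infty(\Gamma,B_s(H);d\mu)$ is such that there is $\alpha>0$ with $\alpha\|v\|^2\le a(v,v;\gamma)$ for all $v\in H$ and $\mu$-a.e. $\gamma\in\Gamma$, where $a(\cdot,\cdot;\gamma)$ denotes the form $a(\gamma)$. For $v,w\in L^2(\Gamma,H;d\mu)$ set $$\bar a(v,w)=\int_\Gamma a(v(\gamma),w(\gamma);\gamma)\,d\mu(\gamma).$$ $f\in L^2(\Gamma,H';d\mu)$ is given. $u\in L^2(\Gamma,H;d\mu)$ is the unique solution of $\bar a(u,v)=\int_\Gamma\langle f(\gamma),v(\gamma)\rangle\,d\mu(\gamma)$ for all $v\in L^2(\Gamma,H;d\mu)$; equivalently, for $\mu$-a.e. $\gamma$, $a(u(\gamma),v;\gamma)=\langle f(\gamma),v\rangle$ for all $v\in H$. $\mathcal S_k$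 is the family of all linear subspaces of $H$ of dimension at most $k$. For $v\in L^2(\Gamma,H;d\mu)$ and a closed subspace $Z\subset H$, $v_Z\in L^2(\Gamma,Z;d\mu)$ denotes the unique solution of $\bar a(v_Z,z)=\bar a(v,z)$ for all $z\in L^2(\Gamma,Z;d\mu)$. For $v\in L^2(\Gamma,H;d\mu)$, $$\Pi_k(v)=\Big\{v_W\ :\ W\in\mathcal S_k \text{ is a minimizer of } Z\mapsto \bar a(v-v_Z,v-v_Z) \text{ over } Z\in\mathcal S_k\Big\}.$$ (The set $\Pi_k(v)$ is nonempty for every $v\in L^2(\Gamma,H;d\mu)$, so such sequences exist.) *)

theory Defs
  imports "HOL-Analysis.Analysis"
begin

text \<open>
  Bochner (strong) measurability. For values in a separable metric space it agrees with Borel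
  measurability; the space of bilinear forms on \<open>H\<close>, however, is in general not separable.
\<close>

definition strongly_measurable :: "'g measure \<Rightarrow> ('g \<Rightarrow> 'b::topological_space) \<Rightarrow> bool" where
  "strongly_measurable M v \<longleftrightarrow>
     (\<exists>s. (\<forall>n::nat. simple_function M (s n)) \<and>
          (\<forall>\<gamma>\<in>space M. (\<lambda>n. s n \<gamma>) \<longlonglongrightarrow> v \<gamma>))"

lemma strongly_measurable_iff_borel_measurable:
  fixes v :: "'g \<Rightarrow> 'b::{metric_space, second_countable_topology}"
  shows "strongly_measurable M v \<longleftrightarrow> v \<in> borel_measurable M"
proof
  assume "strongly_measurable M v"
  then obtain s where s: "\<And>n::nat. simple_function M (s n)"
    "\<And>\<gamma>. \<gamma> \<in> space M \<Longrightarrow> (\<lambda>n. s n \<gamma>) \<longlonglongrightarrow> v \<gamma>"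
    unfolding strongly_measurable_def by blast
  show "v \<in> borel_measurable M"
    by (rule borel_measurable_LIMSEQ_metric[of s])
       (use s in \<open>auto intro: borel_measurable_simple_function\<close>)
next
  assume "v \<in> borel_measurable M"
  then show "strongly_measurable M v"
    unfolding strongly_measurable_def
    using borel_measurable_implies_sequence_metric[of v M undefined] by blast
qed

text \<open>
  Elements of the spaces \<open>L\<^sup>2\<close> and \<open>L\<^sup>\<infinity>\<close> are represented by functions rather than by classes of
  almost everywhere equal functions. The argument \<open>S\<close> is the (closed) subspace in which the values
  lie almost everywhere.
\<close>

definition L2 :: "'g measure \<Rightarrow> 'b::real_normed_vector set \<Rightarrow> ('g \<Rightarrow> 'b) set" where
  "L2 M S = {v. strongly_measurable M v \<and> (AE \<gamma> in M. v \<gamma> \<in> S) \<and>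
                integrable M (\<lambda>\<gamma>. (norm (v \<gamma>))\<^sup>2)}"

definition L2_norm :: "'g measure \<Rightarrow> ('g \<Rightarrow> 'b::real_normed_vector) \<Rightarrow> real" where
  "L2_norm M v = sqrt (\<integral>\<gamma>. (norm (v \<gamma>))\<^sup>2 \<partial>M)"

definition Linf :: "'g measure \<Rightarrow> 'b::real_normed_vector set \<Rightarrow> ('g \<Rightarrow> 'b) set" where
  "Linf M S = {v. strongly_measurable M v \<and> (AE \<gamma> in M. v \<gamma> \<in> S) \<and>
                  (\<exists>C. AE \<gamma> in M. norm (v \<gamma>) \<le> C)}"

text \<open>
  Continuous bilinear forms are identified with their curried versions; the operator norm of the
  latter is the usual norm of the form.
\<close>

definition sym_forms :: "('h::real_normed_vector \<Rightarrow>\<^sub>L 'h \<Rightarrow>\<^sub>L real) set" where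
  "sym_forms = {b. \<forall>v w. blinfun_apply (blinfun_apply b v) w = blinfun_apply (blinfun_apply b w) v}"

definition abar ::
  "'g measure \<Rightarrow> ('g \<Rightarrow> 'h::real_normed_vector \<Rightarrow>\<^sub>L 'h \<Rightarrow>\<^sub>L real) \<Rightarrow> ('g \<Rightarrow> 'h) \<Rightarrow> ('g \<Rightarrow> 'h) \<Rightarrow> real" where
  "abar M a v w = (\<integral>\<gamma>. blinfun_apply (blinfun_apply (a \<gamma>) (v \<gamma>)) (w \<gamma>) \<partial>M)"

text \<open>
  Finite dimensionality is required explicitly because \<^const>\<open>dim\<close> is \<open>0\<close> on infinite-dimensional
  subspaces.
\<close>

definition subspaces_le :: "nat \<Rightarrow> 'h::real_vector set set" where
  "subspaces_le k = {Z. subspace Z \<and> (\<exists>B. finite B \<and> Z \<subseteq> span B) \<and> dim Z \<le> k}"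

text \<open>
  \<open>is_proj M a Z v w\<close>: the function \<open>w\<close> represents \<open>v\<^sub>Z\<close>, which is unique up to equality almost
  everywhere. \<open>proj M a Z v\<close> is one such representative.
\<close>

definition is_proj ::
  "'g measure \<Rightarrow> ('g \<Rightarrow> 'h::real_normed_vector \<Rightarrow>\<^sub>L 'h \<Rightarrow>\<^sub>L real) \<Rightarrow> 'h set \<Rightarrow> ('g \<Rightarrow> 'h) \<Rightarrow> ('g \<Rightarrow> 'h) \<Rightarrow> bool" where
  "is_proj M a Z v w \<longleftrightarrow> w \<in> L2 M Z \<and> (\<forall>z\<in>L2 M Z. abar M a w z = abar M a v z)"

definition proj ::
  "'g measure \<Rightarrow> ('g \<Rightarrow> 'h::real_normed_vector \<Rightarrow>\<^sub>L 'h \<Rightarrow>\<^sub>L real) \<Rightarrow> 'h set \<Rightarrow> ('g \<Rightarrow> 'h) \<Rightarrow> 'g \<Rightarrow> 'h" where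
  "proj M a Z v = (SOME w. is_proj M a Z v w)"

definition proj_error ::
  "'g measure \<Rightarrow> ('g \<Rightarrow> 'h::real_normed_vector \<Rightarrow>\<^sub>L 'h \<Rightarrow>\<^sub>L real) \<Rightarrow> ('g \<Rightarrow> 'h) \<Rightarrow> 'h set \<Rightarrow> real" where
  "proj_error M a v Z =
     abar M a (\<lambda>\<gamma>. v \<gamma> - proj M a Z v \<gamma>) (\<lambda>\<gamma>. v \<gamma> - proj M a Z v \<gamma>)"

text \<open>All representatives of the optimal projections are included.\<close>

definition Pi_opt ::
  "'g measure \<Rightarrow> ('g \<Rightarrow> 'h::real_normed_vector \<Rightarrow>\<^sub>L 'h \<Rightarrow>\<^sub>L real) \<Rightarrow> nat \<Rightarrow> ('g \<Rightarrow> 'h) \<Rightarrow> ('g \<Rightarrow> 'h) set" where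
  "Pi_opt M a k v =
     {w. \<exists>W. is_arg_min (proj_error M a v) (\<lambda>Z. Z \<in> subspaces_le k) W \<and> is_proj M a W v w}"

end

theory Submission
  imports Defs
begin

text \<open>
  The proof is the convergence proof for greedy algorithms in Hilbert space, run in the energy inner
  product \<open>\<langle>v, w\<rangle> = abar M a v w\<close>, whose norm is equivalent to that of \<open>L\<^sup>2\<close>. Let \<open>e\<^sub>m\<close> be the
  error after \<open>m\<close> steps, \<open>t\<^sub>m\<close> the optimal projection of \<open>e\<^sub>m\<close> that is subtracted next, and
  \<open>x\<^sub>m = |t\<^sub>m|\<close>. Since \<open>t\<^sub>m\<close> is an orthogonal projection of \<open>e\<^sub>m\<close>, the energies
  \<open>|e\<^sub>m|\<^sup>2\<close> decrease by \<open>x\<^sub>m\<^sup>2\<close>; hence \<open>\<Sum>x\<^sub>m\<^sup>2 < \<infinity>\<close>.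

  Optimality means that no other subspace captures more of \<open>e\<^sub>m\<close>. If \<open>z\<close> takes values in a fixed
  line, then \<open>\<langle>e\<^sub>m, z\<rangle>\<close> only depends on the projection of \<open>e\<^sub>m\<close> onto that line, whence
  \<open>|\<langle>e\<^sub>m, z\<rangle>| \<le> x\<^sub>m |z|\<close> (lemma \<open>abar_line_le_optimal\<close>). A function with values in a space of
  dimension at most \<open>k\<close> is a sum of \<open>k\<close> such functions, which gives
  \<open>|\<langle>e\<^sub>m, t\<^sub>j\<rangle>| \<le> K x\<^sub>m x\<^sub>j\<close> with a constant \<open>K\<close> independent of the spaces
  (lemma \<open>abar_subspace_le_optimal\<close>). Passing through lines costs the factor \<open>K\<close>, but the only
  projections that have to be constructed are those onto lines, where there is an explicit formula.

  Finally \<open>e\<^sub>m = u - \<Sum>\<^sub>j\<^sub><\<^sub>m t\<^sub>j\<close>, so \<open>|e\<^sub>m|\<^sup>2\<close> is \<open>\<langle>e\<^sub>m, u\<rangle>\<close> up to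
  \<open>K x\<^sub>m \<Sum>\<^sub>j\<^sub><\<^sub>m x\<^sub>j\<close>. The latter is small for suitable arbitrarily large \<open>m\<close>, because
  \<open>\<Sum>x\<^sub>j\<^sup>2 < \<infinity>\<close> (lemma \<open>square_summable_times_partial_sum_small\<close>), and \<open>\<langle>e\<^sub>m, u\<rangle>\<close> becomes
  small because \<open>u\<close> is approximated by finite sums of functions with values in lines
  (lemma \<open>L2_approx_by_lines\<close>). As the energies decrease, smallness along such \<open>m\<close> is enough.
\<close>

section \<open>Square integrable functions\<close>

lemma L2_UNIV_iff:
  fixes v :: "'g \<Rightarrow> 'h::{real_normed_vector, second_countable_topology}"
  shows "v \<in> L2 M UNIV \<longleftrightarrow> v \<in> borel_measurable M \<and> integrable M (\<lambda>\<gamma>. (norm (v \<gamma>))\<^sup>2)"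
  by (simp add: L2_def strongly_measurable_iff_borel_measurable)

lemma L2_iff:
  fixes v :: "'g \<Rightarrow> 'h::{real_normed_vector, second_countable_topology}"
  shows "v \<in> L2 M S \<longleftrightarrow> v \<in> L2 M UNIV \<and> (AE \<gamma> in M. v \<gamma> \<in> S)"
  by (auto simp: L2_def)

lemma L2_dominated:
  fixes v w :: "'g \<Rightarrow> 'h::{real_normed_vector, second_countable_topology}"
  assumes v: "v \<in> L2 M UNIV" and w: "w \<in> borel_measurable M"
    and le: "AE \<gamma> in M. norm (w \<gamma>) \<le> c * norm (v \<gamma>)"
  shows "w \<in> L2 M UNIV"
proof -
  have int: "integrable M (\<lambda>\<gamma>. c\<^sup>2 * (norm (v \<gamma>))\<^sup>2)"
    using v by (simp add: L2_UNIV_iff)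
  have le2: "AE \<gamma> in M. norm ((norm (w \<gamma>))\<^sup>2) \<le> norm (c\<^sup>2 * (norm (v \<gamma>))\<^sup>2)"
    using le
  proof eventually_elim
    case (elim \<gamma>)
    then have "(norm (w \<gamma>))\<^sup>2 \<le> (c * norm (v \<gamma>))\<^sup>2"
      by (intro power_mono) auto
    then show ?case by (simp add: power_mult_distrib)
  qed
  have "integrable M (\<lambda>\<gamma>. (norm (w \<gamma>))\<^sup>2)"
    by (rule Bochner_Integration.integrable_bound[OF int _ le2]) (use w in auto)
  then show ?thesis using w by (simp add: L2_UNIV_iff)
qed

lemma L2_scaleR:
  fixes v :: "'g \<Rightarrow> 'h::{real_normed_vector, second_countable_topology}"
  assumes "v \<in> L2 M UNIV"
  shows "(\<lambda>\<gamma>. c *\<^sub>R v \<gamma>) \<in> L2 M UNIV"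
  by (rule L2_dominated[OF assms, where c = "\<bar>c\<bar>"]) (use assms in \<open>auto simp: L2_UNIV_iff\<close>)

lemma L2_add:
  fixes v w :: "'g \<Rightarrow> 'h::{real_normed_vector, second_countable_topology}"
  assumes v: "v \<in> L2 M UNIV" and w: "w \<in> L2 M UNIV"
  shows "(\<lambda>\<gamma>. v \<gamma> + w \<gamma>) \<in> L2 M UNIV"
proof -
  have le: "(norm (x + y))\<^sup>2 \<le> 2 * (norm x)\<^sup>2 + 2 * (norm y)\<^sup>2" for x y :: 'h
  proof -
    have "(norm (x + y))\<^sup>2 \<le> (norm x + norm y)\<^sup>2"
      by (intro power_mono norm_triangle_ineq) auto
    also have "\<dots> \<le> 2 * (norm x)\<^sup>2 + 2 * (norm y)\<^sup>2"
      using sum_squares_bound[of "norm x" "norm y"] by (simp add: power2_sum)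
    finally show ?thesis .
  qed
  have "integrable M (\<lambda>\<gamma>. 2 * (norm (v \<gamma>))\<^sup>2 + 2 * (norm (w \<gamma>))\<^sup>2)"
    using v w by (simp add: L2_UNIV_iff)
  then have "integrable M (\<lambda>\<gamma>. (norm (v \<gamma> + w \<gamma>))\<^sup>2)"
    by (rule Bochner_Integration.integrable_bound) (use v w le in \<open>auto simp: L2_UNIV_iff\<close>)
  then show ?thesis using v w by (auto simp: L2_UNIV_iff)
qed

lemma L2_diff:
  fixes v w :: "'g \<Rightarrow> 'h::{real_normed_vector, second_countable_topology}"
  assumes "v \<in> L2 M UNIV" and "w \<in> L2 M UNIV"
  shows "(\<lambda>\<gamma>. v \<gamma> - w \<gamma>) \<in> L2 M UNIV"
  using L2_add[OF assms(1) L2_scaleR[OF assms(2), of "-1"]] by simp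

lemma L2_sum:
  fixes v :: "'i \<Rightarrow> 'g \<Rightarrow> 'h::{real_normed_vector, second_countable_topology}"
  assumes "\<And>i. i \<in> I \<Longrightarrow> v i \<in> L2 M UNIV"
  shows "(\<lambda>\<gamma>. \<Sum>i\<in>I. v i \<gamma>) \<in> L2 M UNIV"
  using assms
proof (induction I rule: infinite_finite_induct)
  case (insert i I)
  then show ?case using L2_add[of "v i" M "\<lambda>\<gamma>. \<Sum>i\<in>I. v i \<gamma>"] by simp
qed (auto simp: L2_UNIV_iff)

text \<open>
  A square integrable function is a dominated limit of simple functions, and a simple function is
  the sum, over its finitely many values \<open>y\<close>, of functions with values in the line through \<open>y\<close>.
  Hence functions with values in a line span a dense subspace.
\<close>

lemma L2_approx_by_lines:
  fixes v :: "'g \<Rightarrow> 'h::{real_normed_vector, second_countable_topology}"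
  assumes v: "v \<in> L2 M UNIV" and "\<epsilon> > 0"
  shows "\<exists>Y z. finite Y \<and> (\<forall>y\<in>Y. z y \<in> L2 M (span {y})) \<and>
    (\<integral>\<gamma>. (norm (v \<gamma> - (\<Sum>y\<in>Y. z y \<gamma>)))\<^sup>2 \<partial>M) < \<epsilon>"
proof -
  have vm: "v \<in> borel_measurable M" and vi: "integrable M (\<lambda>\<gamma>. (norm (v \<gamma>))\<^sup>2)"
    using v by (auto simp: L2_UNIV_iff)
  from borel_measurable_implies_sequence_metric[OF vm, of 0] obtain s where
    s: "\<And>i. simple_function M (s i)" "\<And>\<gamma>. \<gamma> \<in> space M \<Longrightarrow> (\<lambda>i. s i \<gamma>) \<longlonglongrightarrow> v \<gamma>"
       "\<And>i \<gamma>. \<gamma> \<in> space M \<Longrightarrow> norm (s i \<gamma>) \<le> 2 * norm (v \<gamma>)"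
    unfolding norm_conv_dist by metis
  have sm: "s i \<in> borel_measurable M" for i
    using s(1) by (rule borel_measurable_simple_function)
  have "(\<lambda>i. \<integral>\<gamma>. (norm (v \<gamma> - s i \<gamma>))\<^sup>2 \<partial>M) \<longlonglongrightarrow> (\<integral>\<gamma>. 0 \<partial>M)"
  proof (rule integral_dominated_convergence[where w = "\<lambda>\<gamma>. 9 * (norm (v \<gamma>))\<^sup>2"])
    show "AE \<gamma> in M. norm ((norm (v \<gamma> - s i \<gamma>))\<^sup>2) \<le> 9 * (norm (v \<gamma>))\<^sup>2" for i
    proof (rule AE_I2)
      fix \<gamma> assume "\<gamma> \<in> space M"
      then have "norm (v \<gamma> - s i \<gamma>) \<le> 3 * norm (v \<gamma>)"
        using s(3)[of \<gamma> i] norm_triangle_ineq4[of "v \<gamma>" "s i \<gamma>"] by linarith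
      then have "(norm (v \<gamma> - s i \<gamma>))\<^sup>2 \<le> (3 * norm (v \<gamma>))\<^sup>2"
        by (intro power_mono) auto
      then show "norm ((norm (v \<gamma> - s i \<gamma>))\<^sup>2) \<le> 9 * (norm (v \<gamma>))\<^sup>2"
        by (simp add: power_mult_distrib)
    qed
    show "AE \<gamma> in M. (\<lambda>i. (norm (v \<gamma> - s i \<gamma>))\<^sup>2) \<longlonglongrightarrow> 0"
    proof (rule AE_I2)
      fix \<gamma> assume "\<gamma> \<in> space M"
      then have "(\<lambda>i. (norm (v \<gamma> - s i \<gamma>))\<^sup>2) \<longlonglongrightarrow> (norm (v \<gamma> - v \<gamma>))\<^sup>2"
        by (intro tendsto_intros s)
      then show "(\<lambda>i. (norm (v \<gamma> - s i \<gamma>))\<^sup>2) \<longlonglongrightarrow> 0" by simp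
    qed
  qed (use vm sm vi in auto)
  then have "\<forall>\<^sub>F i in sequentially. (\<integral>\<gamma>. (norm (v \<gamma> - s i \<gamma>))\<^sup>2 \<partial>M) < \<epsilon>"
    using \<open>\<epsilon> > 0\<close> by (intro order_tendstoD) auto
  then obtain i where i: "(\<integral>\<gamma>. (norm (v \<gamma> - s i \<gamma>))\<^sup>2 \<partial>M) < \<epsilon>"
    by (auto simp: eventually_sequentially)
  define Y where "Y = s i ` space M"
  define z where "z y = (\<lambda>\<gamma>. if s i \<gamma> = y then y else 0)" for y
  have fin: "finite Y" unfolding Y_def by (rule simple_functionD(1)[OF s(1)])
  have z: "z y \<in> L2 M (span {y})" for y
  proof -
    have "z y \<in> borel_measurable M"
      unfolding z_def using sm[of i] by measurable
    moreover have "AE \<gamma> in M. norm (z y \<gamma>) \<le> 2 * norm (v \<gamma>)"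
      using s(3)[of _ i] by (auto simp: z_def)
    ultimately have "z y \<in> L2 M UNIV" by (rule L2_dominated[OF v])
    then show ?thesis
      by (subst L2_iff) (auto simp: z_def intro: span_base span_zero)
  qed
  have "(\<integral>\<gamma>. (norm (v \<gamma> - (\<Sum>y\<in>Y. z y \<gamma>)))\<^sup>2 \<partial>M) = (\<integral>\<gamma>. (norm (v \<gamma> - s i \<gamma>))\<^sup>2 \<partial>M)"
    by (rule Bochner_Integration.integral_cong) (auto simp: z_def Y_def fin[unfolded Y_def])
  with i fin z show ?thesis by (intro exI[of _ Y] exI[of _ z]) auto
qed

section \<open>Subspaces of bounded dimension\<close>

text \<open>
  The vector \<open>0\<close> may belong to \<open>C\<close>: its term vanishes, so no basis has to be extracted.
\<close>

lemma orthogonal_expansion: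
  fixes C :: "'h::real_inner set"
  assumes "finite C" "pairwise orthogonal C" "x \<in> span C"
  shows "x = (\<Sum>c\<in>C. (c \<bullet> x / (c \<bullet> c)) *\<^sub>R c)"
  using \<open>x \<in> span C\<close>
proof (induction rule: span_induct_alt)
  case base
  then show ?case by simp
next
  case (step r y x)
  have "(\<Sum>c\<in>C. (c \<bullet> y / (c \<bullet> c)) *\<^sub>R c) = (\<Sum>c\<in>C. if c = y then y else 0)"
    using step assms(2) by (intro sum.cong) (auto simp: pairwise_def orthogonal_def)
  also have "\<dots> = y" using step assms(1) by simp
  finally have "r *\<^sub>R y = (\<Sum>c\<in>C. (r * (c \<bullet> y) / (c \<bullet> c)) *\<^sub>R c)"
    by (simp flip: scaleR_sum_right scaleR_scaleR times_divide_eq_right)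
  then have "r *\<^sub>R y + x = (\<Sum>c\<in>C. (r * (c \<bullet> y) / (c \<bullet> c)) *\<^sub>R c) + (\<Sum>c\<in>C. (c \<bullet> x / (c \<bullet> c)) *\<^sub>R c)"
    using step.IH by metis
  also have "\<dots> = (\<Sum>c\<in>C. (c \<bullet> (r *\<^sub>R y + x) / (c \<bullet> c)) *\<^sub>R c)"
    by (simp add: inner_add_right add_divide_distrib scaleR_add_left sum.distrib)
  finally show ?case .
qed

lemma norm_orthogonal_component_le:
  fixes c x :: "'h::real_inner"
  shows "norm ((c \<bullet> x / (c \<bullet> c)) *\<^sub>R c) \<le> norm x"
proof (cases "c = 0")
  case False
  have "\<bar>c \<bullet> x\<bar> \<le> norm c * norm x" by (rule Cauchy_Schwarz_ineq2)
  with False show ?thesis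
    by (simp add: dot_square_norm power2_eq_square field_simps)
qed simp

lemma subspaces_le_orthogonal_basis:
  fixes Z :: "'h::real_inner set"
  assumes "Z \<in> subspaces_le k"
  obtains C where "finite C" "card C \<le> k" "pairwise orthogonal C" "Z \<subseteq> span C"
proof -
  from assms obtain B0 where B0: "finite B0" "Z \<subseteq> span B0" and k: "dim Z \<le> k"
    unfolding subspaces_le_def by auto
  obtain B where B: "B \<subseteq> Z" "independent B" "Z \<subseteq> span B" "card B = dim Z"
    using basis_exists by blast
  have "finite B"
    using independent_span_bound[OF B0(1) B(2)] B(1) B0(2) by auto
  then obtain C where "finite C" "card C \<le> card B" "span C = span B" "pairwise orthogonal C"
    using basis_orthogonal by blast
  with B k show thesis by (intro that[of C]) auto
qed

lemma line_in_subspaces_le: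
  assumes "k \<ge> 1"
  shows "span {b} \<in> subspaces_le k"
proof -
  have "dim (span {b}) \<le> card {b}" by (rule dim_le_card) auto
  with assms show ?thesis
    unfolding subspaces_le_def by (auto intro!: exI[of _ "{b}"])
qed

section \<open>A sequence inequality\<close>

text \<open>
  If \<open>x\<^sub>m (x\<^sub>0 + \<dots> + x\<^sub>m) \<ge> \<delta>\<close> for all \<open>m \<ge> N\<close>, then the Cauchy-Schwarz bound
  \<open>(x\<^sub>0 + \<dots> + x\<^sub>m)\<^sup>2 \<le> A (m + 1)\<close>, where \<open>A\<close> bounds
  \<open>\<Sum>x\<^sub>j\<^sup>2\<close>, would make \<open>x\<^sub>m\<^sup>2\<close> at least a multiple of \<open>1 / (m + 1)\<close>, and the harmonic series diverges.
\<close>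

lemma square_summable_times_partial_sum_small:
  fixes x :: "nat \<Rightarrow> real"
  assumes nonneg: "\<And>n. 0 \<le> x n" and sq: "summable (\<lambda>n. (x n)\<^sup>2)" and "\<delta> > 0"
  shows "\<exists>m\<ge>N. x m * (\<Sum>j\<le>m. x j) < \<delta>"
proof (rule ccontr)
  assume "\<not> ?thesis"
  then have ge: "\<delta> \<le> x m * (\<Sum>j\<le>m. x j)" if "m \<ge> N" for m
    using that by force
  define A where "A = (\<Sum>n. (x n)\<^sup>2) + 1"
  have A: "A > 0" unfolding A_def using suminf_nonneg[OF sq] by simp
  have lower: "\<delta>\<^sup>2 / A * inverse (of_nat (Suc m)) \<le> (x m)\<^sup>2" if "m \<ge> N" for m
  proof -
    have "(\<Sum>j\<le>m. x j)\<^sup>2 \<le> (\<Sum>j\<le>m. (x j)\<^sup>2) * card {..m}"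
      by (rule sum_squared_le_sum_of_squares)
    also have "\<dots> \<le> A * real (Suc m)"
      using sum_le_suminf[OF sq, of "{..m}"] A by (intro mult_mono) (auto simp: A_def)
    finally have S: "(\<Sum>j\<le>m. x j)\<^sup>2 \<le> A * real (Suc m)" .
    have "\<delta>\<^sup>2 \<le> (x m * (\<Sum>j\<le>m. x j))\<^sup>2"
      using ge[OF that] \<open>\<delta> > 0\<close> by (intro power_mono) auto
    also have "\<dots> \<le> (x m)\<^sup>2 * (A * real (Suc m))"
      unfolding power_mult_distrib using S by (intro mult_left_mono) auto
    finally have "\<delta>\<^sup>2 \<le> (x m)\<^sup>2 * (A * real (Suc m))" .
    then have "\<delta>\<^sup>2 / (A * real (Suc m)) \<le> (x m)\<^sup>2"
      using A by (subst pos_divide_le_eq) auto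
    then show ?thesis by (simp add: divide_inverse mult.assoc)
  qed
  have "summable (\<lambda>m. \<delta>\<^sup>2 / A * inverse (of_nat (Suc m) :: real))"
    by (rule summable_comparison_test'[OF sq, of N]) (use lower A in auto)
  then have "summable (\<lambda>m. inverse (of_nat (Suc m) :: real))"
    using \<open>\<delta> > 0\<close> A summable_cmult_iff[of "\<delta>\<^sup>2 / A"] by simp
  then show False
    using not_summable_harmonic[where 'a = real]
    by (subst (asm) summable_Suc_iff[of "\<lambda>m. inverse (of_nat m)"]) auto
qed

section \<open>Parametrized coercive forms\<close>

locale parametrized_form =
  fixes M :: "'g measure"
    and a :: "'g \<Rightarrow> 'h::{real_inner, second_countable_topology} \<Rightarrow>\<^sub>L 'h \<Rightarrow>\<^sub>L real"
    and \<alpha> C :: real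
  assumes strongly_measurable: "strongly_measurable M a"
    and symmetric: "AE \<gamma> in M. a \<gamma> \<in> sym_forms"
    and bound_nonneg: "C \<ge> 0"
    and bounded: "AE \<gamma> in M. norm (a \<gamma>) \<le> C"
    and coercivity_pos: "\<alpha> > 0"
    and coercive: "AE \<gamma> in M. \<forall>v. \<alpha> * (norm v)\<^sup>2 \<le> a \<gamma> v v"
begin

text \<open>
  For a fixed form \<open>b\<close> the function \<open>b(v, w)\<close> is measurable because \<open>H\<close> is separable. The space of
  forms is in general not separable, so for the varying form \<open>a(\<gamma>)\<close> one passes through approximating
  simple functions, each of which takes finitely many forms as values.
\<close>

lemma form_measurable:
  assumes v: "v \<in> borel_measurable M" and w: "w \<in> borel_measurable M"
  shows "(\<lambda>\<gamma>. a \<gamma> (v \<gamma>) (w \<gamma>)) \<in> borel_measurable M"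
proof -
  from strongly_measurable obtain s where s: "\<And>n::nat. simple_function M (s n)"
    "\<And>\<gamma>. \<gamma> \<in> space M \<Longrightarrow> (\<lambda>n. s n \<gamma>) \<longlonglongrightarrow> a \<gamma>"
    unfolding strongly_measurable_def by blast
  have fixed: "(\<lambda>\<gamma>. blinfun_apply (blinfun_apply b (v \<gamma>)) (w \<gamma>)) \<in> borel_measurable M"
    for b :: "'h \<Rightarrow>\<^sub>L 'h \<Rightarrow>\<^sub>L real"
    by (rule borel_measurable_continuous_Pair[OF v w]) (intro continuous_intros)
  have "(\<lambda>\<gamma>. s n \<gamma> (v \<gamma>) (w \<gamma>)) \<in> borel_measurable M" for n
  proof (rule measurable_compose_countable'[where I = "s n ` space M"
        and f = "\<lambda>b \<gamma>. blinfun_apply (blinfun_apply b (v \<gamma>)) (w \<gamma>)" and g = "s n"])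
    show "s n \<in> M \<rightarrow>\<^sub>M count_space (s n ` space M)"
      using s(1)[of n] by (rule measurable_simple_function[THEN measurable_count_space_extend[rotated 2]]) auto
    show "countable (s n ` space M)"
      by (intro countable_finite simple_functionD(1) s)
  qed (rule fixed)
  then show ?thesis
  proof (rule borel_measurable_LIMSEQ_metric)
    fix \<gamma> assume "\<gamma> \<in> space M"
    then show "(\<lambda>n. s n \<gamma> (v \<gamma>) (w \<gamma>)) \<longlonglongrightarrow> a \<gamma> (v \<gamma>) (w \<gamma>)"
      by (intro tendsto_intros s)
  qed
qed

lemma form_bound:
  "AE \<gamma> in M. \<forall>x y. \<bar>a \<gamma> x y\<bar> \<le> C * norm x * norm y"
  using bounded
proof eventually_elim
  case (elim \<gamma>)
  have "\<bar>a \<gamma> x y\<bar> \<le> C * norm x * norm y" for x y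
  proof -
    have "\<bar>a \<gamma> x y\<bar> \<le> norm (a \<gamma> x) * norm y"
      using norm_blinfun[of "a \<gamma> x" y] by simp
    also have "\<dots> \<le> (norm (a \<gamma>) * norm x) * norm y"
      by (intro mult_right_mono norm_blinfun) auto
    also have "\<dots> \<le> C * norm x * norm y"
      using elim by (intro mult_right_mono) auto
    finally show ?thesis .
  qed
  then show ?case by blast
qed

lemma form_integrable:
  assumes v: "v \<in> L2 M UNIV" and w: "w \<in> L2 M UNIV"
  shows "integrable M (\<lambda>\<gamma>. a \<gamma> (v \<gamma>) (w \<gamma>))"
proof -
  have int: "integrable M (\<lambda>\<gamma>. C * ((norm (v \<gamma>))\<^sup>2 + (norm (w \<gamma>))\<^sup>2))"
    using v w by (simp add: L2_UNIV_iff)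
  have le: "AE \<gamma> in M. norm (a \<gamma> (v \<gamma>) (w \<gamma>)) \<le> norm (C * ((norm (v \<gamma>))\<^sup>2 + (norm (w \<gamma>))\<^sup>2))"
    using form_bound
  proof eventually_elim
    case (elim \<gamma>)
    then have "\<bar>a \<gamma> (v \<gamma>) (w \<gamma>)\<bar> \<le> C * (norm (v \<gamma>) * norm (w \<gamma>))" by (simp add: mult.assoc)
    also have "\<dots> \<le> C * ((norm (v \<gamma>))\<^sup>2 + (norm (w \<gamma>))\<^sup>2)"
    proof (intro mult_left_mono bound_nonneg)
      have "0 \<le> norm (v \<gamma>) * norm (w \<gamma>)" by simp
      then show "norm (v \<gamma>) * norm (w \<gamma>) \<le> (norm (v \<gamma>))\<^sup>2 + (norm (w \<gamma>))\<^sup>2"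
        using sum_squares_bound[of "norm (v \<gamma>)" "norm (w \<gamma>)"] by linarith
    qed
    finally show ?case by simp
  qed
  show ?thesis
    by (rule Bochner_Integration.integrable_bound[OF int _ le])
       (use v w in \<open>auto simp: L2_UNIV_iff intro: form_measurable\<close>)
qed

lemma abar_cong_AE:
  assumes "v \<in> L2 M UNIV" "v' \<in> L2 M UNIV" "w \<in> L2 M UNIV" "w' \<in> L2 M UNIV"
    and "AE \<gamma> in M. v \<gamma> = v' \<gamma>" "AE \<gamma> in M. w \<gamma> = w' \<gamma>"
  shows "abar M a v w = abar M a v' w'"
  unfolding abar_def
proof (rule integral_cong_AE)
  show "AE \<gamma> in M. a \<gamma> (v \<gamma>) (w \<gamma>) = a \<gamma> (v' \<gamma>) (w' \<gamma>)"
    using assms(5,6) by eventually_elim simp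
qed (use assms in \<open>auto simp: L2_UNIV_iff intro: form_measurable\<close>)

lemma abar_commute:
  assumes "v \<in> L2 M UNIV" "w \<in> L2 M UNIV"
  shows "abar M a v w = abar M a w v"
  unfolding abar_def
proof (rule integral_cong_AE)
  show "AE \<gamma> in M. a \<gamma> (v \<gamma>) (w \<gamma>) = a \<gamma> (w \<gamma>) (v \<gamma>)"
    using symmetric by (auto simp: sym_forms_def)
qed (use assms in \<open>auto simp: L2_UNIV_iff intro: form_measurable\<close>)

lemma abar_add_right:
  assumes "v \<in> L2 M UNIV" "w \<in> L2 M UNIV" "w' \<in> L2 M UNIV"
  shows "abar M a v (\<lambda>\<gamma>. w \<gamma> + w' \<gamma>) = abar M a v w + abar M a v w'"
  unfolding abar_def blinfun.add_right
  using assms by (intro Bochner_Integration.integral_add form_integrable)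

lemma abar_diff_right:
  assumes "v \<in> L2 M UNIV" "w \<in> L2 M UNIV" "w' \<in> L2 M UNIV"
  shows "abar M a v (\<lambda>\<gamma>. w \<gamma> - w' \<gamma>) = abar M a v w - abar M a v w'"
  unfolding abar_def blinfun.diff_right
  using assms by (intro Bochner_Integration.integral_diff form_integrable)

lemma abar_scaleR_right:
  "abar M a v (\<lambda>\<gamma>. c *\<^sub>R w \<gamma>) = c * abar M a v w"
  unfolding abar_def by (simp add: blinfun.scaleR_right)

lemma abar_sum_right:
  assumes "v \<in> L2 M UNIV" "\<And>i. i \<in> I \<Longrightarrow> w i \<in> L2 M UNIV"
  shows "abar M a v (\<lambda>\<gamma>. \<Sum>i\<in>I. w i \<gamma>) = (\<Sum>i\<in>I. abar M a v (w i))"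
  unfolding abar_def blinfun.sum_right
  using assms by (intro Bochner_Integration.integral_sum form_integrable)

lemma abar_diff_square:
  assumes "v \<in> L2 M UNIV" "w \<in> L2 M UNIV"
  shows "abar M a (\<lambda>\<gamma>. v \<gamma> - w \<gamma>) (\<lambda>\<gamma>. v \<gamma> - w \<gamma>) =
    abar M a v v - 2 * abar M a v w + abar M a w w"
  using assms abar_commute[OF assms]
    abar_commute[OF L2_diff[OF assms] assms(1)] abar_commute[OF L2_diff[OF assms] assms(2)]
  by (simp add: abar_diff_right L2_diff)

lemma abar_ge_L2_norm:
  assumes v: "v \<in> L2 M UNIV"
  shows "\<alpha> * (\<integral>\<gamma>. (norm (v \<gamma>))\<^sup>2 \<partial>M) \<le> abar M a v v"
proof -
  have "(\<integral>\<gamma>. \<alpha> * (norm (v \<gamma>))\<^sup>2 \<partial>M) \<le> abar M a v v"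
    unfolding abar_def
  proof (rule integral_mono_AE)
    show "AE \<gamma> in M. \<alpha> * (norm (v \<gamma>))\<^sup>2 \<le> a \<gamma> (v \<gamma>) (v \<gamma>)"
      using coercive by eventually_elim auto
  qed (use v in \<open>auto simp: L2_UNIV_iff intro!: form_integrable\<close>)
  then show ?thesis by simp
qed

lemma abar_le_L2_norm:
  assumes v: "v \<in> L2 M UNIV"
  shows "abar M a v v \<le> C * (\<integral>\<gamma>. (norm (v \<gamma>))\<^sup>2 \<partial>M)"
proof -
  have "abar M a v v \<le> (\<integral>\<gamma>. C * (norm (v \<gamma>))\<^sup>2 \<partial>M)"
    unfolding abar_def
  proof (rule integral_mono_AE)
    show "AE \<gamma> in M. a \<gamma> (v \<gamma>) (v \<gamma>) \<le> C * (norm (v \<gamma>))\<^sup>2"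
      using form_bound
      by eventually_elim (auto simp: power2_eq_square mult.assoc dest: abs_le_D1)
  qed (use v in \<open>auto simp: L2_UNIV_iff intro!: form_integrable\<close>)
  then show ?thesis by simp
qed

lemma abar_nonneg:
  assumes "v \<in> L2 M UNIV"
  shows "0 \<le> abar M a v v"
proof -
  have "0 \<le> \<alpha> * (\<integral>\<gamma>. (norm (v \<gamma>))\<^sup>2 \<partial>M)"
    using coercivity_pos by simp
  then show ?thesis using abar_ge_L2_norm[OF assms] by linarith
qed

definition energy_norm :: "('g \<Rightarrow> 'h) \<Rightarrow> real" where
  "energy_norm v = sqrt (abar M a v v)"

lemma energy_norm_nonneg: "v \<in> L2 M UNIV \<Longrightarrow> 0 \<le> energy_norm v"
  by (simp add: energy_norm_def abar_nonneg)

lemma energy_norm_square: "v \<in> L2 M UNIV \<Longrightarrow> (energy_norm v)\<^sup>2 = abar M a v v"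
  by (simp add: energy_norm_def abar_nonneg)

lemma abar_Cauchy_Schwarz:
  assumes v: "v \<in> L2 M UNIV" and w: "w \<in> L2 M UNIV"
  shows "\<bar>abar M a v w\<bar> \<le> energy_norm v * energy_norm w"
proof -
  define p q r where "p = abar M a v v" and "q = abar M a w w" and "r = abar M a v w"
  have nonneg: "0 \<le> p - 2 * t * r + t\<^sup>2 * q" for t
  proof -
    have "abar M a (\<lambda>\<gamma>. t *\<^sub>R w \<gamma>) (\<lambda>\<gamma>. t *\<^sub>R w \<gamma>) = t\<^sup>2 * q"
      using abar_commute[OF L2_scaleR[OF w] w, of t]
      by (simp add: abar_scaleR_right q_def power2_eq_square)
    then show ?thesis
      using abar_nonneg[OF L2_diff[OF v L2_scaleR[OF w, of t]]]
      by (simp add: abar_diff_square v w L2_scaleR abar_scaleR_right p_def r_def)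
  qed
  have "r\<^sup>2 \<le> p * q"
  proof (cases "q = 0")
    case True
    \<comment> \<open>The bound \<open>p - 2 t r \<ge> 0\<close> is then affine in \<open>t\<close>; at \<open>t = (p + 1) / (2 r)\<close> it would read \<open>-1 \<ge> 0\<close>.\<close>
    have "r = 0"
    proof (rule ccontr)
      assume "r \<noteq> 0"
      then have "2 * ((p + 1) / (2 * r)) * r = p + 1" by simp
      with nonneg[of "(p + 1) / (2 * r)"] True show False by simp
    qed
    with True show ?thesis by simp
  next
    case False
    then have "q > 0" using abar_nonneg[OF w] by (simp add: q_def)
    then show ?thesis using nonneg[of "r / q"] by (simp add: field_simps power2_eq_square)
  qed
  then have "\<bar>r\<bar> \<le> sqrt (p * q)" by (intro real_le_rsqrt) simp
  then show ?thesis by (simp add: p_def q_def r_def energy_norm_def real_sqrt_mult)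
qed

section \<open>Galerkin projections\<close>

text \<open>
  Galerkin orthogonality: \<open>v - w\<close> is orthogonal to \<open>w\<close>, so Pythagoras applies.
\<close>

lemma is_proj_error:
  assumes v: "v \<in> L2 M UNIV" and w: "is_proj M a Z v w"
  shows "abar M a (\<lambda>\<gamma>. v \<gamma> - w \<gamma>) (\<lambda>\<gamma>. v \<gamma> - w \<gamma>) = abar M a v v - abar M a w w"
proof -
  have "w \<in> L2 M UNIV" "abar M a w w = abar M a v w"
    using w unfolding is_proj_def by (auto simp: L2_iff[of w M Z])
  then show ?thesis by (simp add: abar_diff_square v)
qed

lemma is_proj_energy_unique:
  assumes w: "is_proj M a Z v w" and w': "is_proj M a Z v w'"
  shows "abar M a w w = abar M a w' w'"
proof -
  have L: "w \<in> L2 M Z" "w' \<in> L2 M Z" "w \<in> L2 M UNIV" "w' \<in> L2 M UNIV"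
    using w w' unfolding is_proj_def by (auto simp: L2_iff[of _ M Z])
  have "abar M a w w = abar M a w' w" "abar M a w' w' = abar M a w w'"
    using w w' L unfolding is_proj_def by auto
  then show ?thesis using abar_commute[OF L(3,4)] by simp
qed

lemma proj_error_eq:
  assumes v: "v \<in> L2 M UNIV" and w: "is_proj M a Z v w"
  shows "proj_error M a v Z = abar M a v v - abar M a w w"
proof -
  have p: "is_proj M a Z v (proj M a Z v)"
    unfolding proj_def using w by (rule someI[of "is_proj M a Z v"])
  show ?thesis
    unfolding proj_error_def is_proj_error[OF v p] is_proj_energy_unique[OF p w] ..
qed

text \<open>
  On a line the projection is explicit, which makes its measurability in \<open>\<gamma>\<close> evident; the
  coefficient is a quotient by \<open>a(b, b; \<gamma>) \<ge> \<alpha> \<parallel>b\<parallel>\<^sup>2\<close>.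
\<close>

lemma is_proj_line_exists:
  assumes v: "v \<in> L2 M UNIV"
  shows "\<exists>w. is_proj M a (span {b}) v w"
proof -
  define w where "w = (\<lambda>\<gamma>. (a \<gamma> (v \<gamma>) b / a \<gamma> b b) *\<^sub>R b)"
  have vm: "v \<in> borel_measurable M" using v by (simp add: L2_UNIV_iff)
  have wm: "w \<in> borel_measurable M"
    unfolding w_def using form_measurable[OF vm, of "\<lambda>_. b"] form_measurable[of "\<lambda>_. b" "\<lambda>_. b"]
    by measurable
  have "AE \<gamma> in M. norm (w \<gamma>) \<le> (C / \<alpha>) * norm (v \<gamma>)"
    using form_bound coercive
  proof eventually_elim
    case (elim \<gamma>)
    show ?case
    proof (cases "b = 0")
      case True
      then show ?thesis using bound_nonneg coercivity_pos by (simp add: w_def)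
    next
      case False
      have pos: "0 < \<alpha> * (norm b)\<^sup>2" using False coercivity_pos by simp
      have "norm (w \<gamma>) = \<bar>a \<gamma> (v \<gamma>) b\<bar> / \<bar>a \<gamma> b b\<bar> * norm b" by (simp add: w_def)
      also have "\<dots> \<le> (C * norm (v \<gamma>) * norm b) / (\<alpha> * (norm b)\<^sup>2) * norm b"
        using elim pos bound_nonneg by (intro mult_right_mono frac_le) (auto intro: order_trans abs_ge_self)
      also have "\<dots> = (C / \<alpha>) * norm (v \<gamma>)"
        using False coercivity_pos by (simp add: power2_eq_square)
      finally show ?thesis .
    qed
  qed
  then have w: "w \<in> L2 M UNIV" by (rule L2_dominated[OF v wm])
  then have wL: "w \<in> L2 M (span {b})"
    by (subst L2_iff) (auto simp: w_def intro: span_mul span_base)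
  have "abar M a w z = abar M a v z" if z: "z \<in> L2 M (span {b})" for z
    unfolding abar_def
  proof (rule integral_cong_AE)
    have zU: "z \<in> L2 M UNIV" and zb: "AE \<gamma> in M. z \<gamma> \<in> span {b}"
      using z by (auto simp: L2_iff[of z M "span {b}"])
    show "(\<lambda>\<gamma>. a \<gamma> (w \<gamma>) (z \<gamma>)) \<in> borel_measurable M" "(\<lambda>\<gamma>. a \<gamma> (v \<gamma>) (z \<gamma>)) \<in> borel_measurable M"
      using v w zU by (auto simp: L2_UNIV_iff intro!: form_measurable)
    show "AE \<gamma> in M. a \<gamma> (w \<gamma>) (z \<gamma>) = a \<gamma> (v \<gamma>) (z \<gamma>)"
      using zb coercive
    proof eventually_elim
      case (elim \<gamma>)
      then obtain c where c: "z \<gamma> = c *\<^sub>R b" by (auto simp: span_singleton)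
      have "b = 0 \<or> a \<gamma> b b \<noteq> 0"
      proof (rule disjCI)
        assume "\<not> a \<gamma> b b \<noteq> 0"
        then have "\<alpha> * (norm b)\<^sup>2 \<le> 0" using elim(2)[rule_format, of b] by simp
        with coercivity_pos show "b = 0" by (simp add: mult_le_0_iff)
      qed
      then show ?case
        by (auto simp: c w_def blinfun.scaleR_left blinfun.scaleR_right)
    qed
  qed
  with wL show ?thesis unfolding is_proj_def by blast
qed

text \<open>
  The projection onto a line captures at most as much energy of \<open>e\<close> as the optimal one, and pairing
  \<open>e\<close> with a function valued in the line only sees that projection.
\<close>

lemma abar_line_le_optimal:
  assumes e: "e \<in> L2 M UNIV" and s: "s \<in> Pi_opt M a k e" and k: "k \<ge> 1"
    and z: "z \<in> L2 M (span {b})"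
  shows "\<bar>abar M a e z\<bar> \<le> energy_norm s * energy_norm z"
proof -
  obtain p where p: "is_proj M a (span {b}) e p" using is_proj_line_exists[OF e] by blast
  have L: "p \<in> L2 M UNIV" "z \<in> L2 M UNIV"
    using p z unfolding is_proj_def by (auto simp: L2_iff[of _ M "span {b}"])
  obtain W where W: "is_arg_min (proj_error M a e) (\<lambda>Z. Z \<in> subspaces_le k) W" "is_proj M a W e s"
    using s unfolding Pi_opt_def by blast
  have "\<not> proj_error M a e (span {b}) < proj_error M a e W"
    using W(1) line_in_subspaces_le[OF k, of b] unfolding is_arg_min_def by blast
  then have "abar M a p p \<le> abar M a s s"
    by (simp add: proj_error_eq[OF e p] proj_error_eq[OF e W(2)])
  then have "energy_norm p \<le> energy_norm s" by (simp add: energy_norm_def)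
  moreover have "abar M a e z = abar M a p z" using p z unfolding is_proj_def by simp
  ultimately show ?thesis
    using abar_Cauchy_Schwarz[OF L] energy_norm_nonneg[OF L(2)]
    by (smt (verit) mult_right_mono)
qed

text \<open>
  A function valued in a space of dimension at most \<open>k\<close> splits along an orthogonal basis into \<open>k\<close>
  functions valued in lines. Orthogonality keeps each component below the whole pointwise in norm,
  so the constant depends on \<open>k\<close>, \<open>\<alpha>\<close> and \<open>C\<close> but not on the space.
\<close>

lemma abar_subspace_le_optimal:
  assumes e: "e \<in> L2 M UNIV" and s: "s \<in> Pi_opt M a k e" and k: "k \<ge> 1"
    and W: "W \<in> subspaces_le k" and z: "z \<in> L2 M W"
  shows "\<bar>abar M a e z\<bar> \<le> k * sqrt (C / \<alpha>) * (energy_norm s * energy_norm z)"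
proof -
  obtain B where B: "finite B" "card B \<le> k" "pairwise orthogonal B" "W \<subseteq> span B"
    using subspaces_le_orthogonal_basis[OF W] .
  have zU: "z \<in> L2 M UNIV" and zW: "AE \<gamma> in M. z \<gamma> \<in> W"
    using z by (auto simp: L2_iff[of z M W])
  have sU: "s \<in> L2 M UNIV"
    using s unfolding Pi_opt_def is_proj_def L2_def by blast
  define y where "y c = (\<lambda>\<gamma>. (c \<bullet> z \<gamma> / (c \<bullet> c)) *\<^sub>R c)" for c
  have le: "norm (y c \<gamma>) \<le> norm (z \<gamma>)" for c \<gamma>
    unfolding y_def by (rule norm_orthogonal_component_le)
  have yU: "y c \<in> L2 M UNIV" for c
  proof (rule L2_dominated[OF zU, where c = 1])
    have [measurable]: "z \<in> borel_measurable M" using zU by (simp add: L2_UNIV_iff)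
    show "y c \<in> borel_measurable M" unfolding y_def by measurable
    show "AE \<gamma> in M. norm (y c \<gamma>) \<le> 1 * norm (z \<gamma>)" using le[of c] by simp
  qed
  have yL: "y c \<in> L2 M (span {c})" for c
    using yU[of c] by (subst L2_iff) (auto simp: y_def intro: span_mul span_base)
  have ynorm: "energy_norm (y c) \<le> sqrt (C / \<alpha>) * energy_norm z" for c
  proof -
    have "abar M a (y c) (y c) \<le> C * (\<integral>\<gamma>. (norm (y c \<gamma>))\<^sup>2 \<partial>M)"
      by (rule abar_le_L2_norm[OF yU])
    also have "\<dots> \<le> C * (\<integral>\<gamma>. (norm (z \<gamma>))\<^sup>2 \<partial>M)"
      using yU[of c] zU le
      by (intro mult_left_mono integral_mono bound_nonneg power_mono) (auto simp: L2_UNIV_iff)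
    also have "\<dots> \<le> C * (abar M a z z / \<alpha>)"
      using abar_ge_L2_norm[OF zU] coercivity_pos
      by (intro mult_left_mono bound_nonneg) (simp add: field_simps)
    finally have "abar M a (y c) (y c) \<le> C / \<alpha> * abar M a z z" by simp
    then show ?thesis
      unfolding energy_norm_def real_sqrt_mult[symmetric] by (rule real_sqrt_le_mono)
  qed
  have "AE \<gamma> in M. z \<gamma> = (\<Sum>c\<in>B. y c \<gamma>)"
    using zW
  proof eventually_elim
    case (elim \<gamma>)
    then show ?case
      unfolding y_def using B by (intro orthogonal_expansion) auto
  qed
  then have "abar M a e z = abar M a e (\<lambda>\<gamma>. \<Sum>c\<in>B. y c \<gamma>)"
    by (intro abar_cong_AE e zU L2_sum yU) auto
  also have "\<dots> = (\<Sum>c\<in>B. abar M a e (y c))"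
    by (rule abar_sum_right[OF e yU])
  finally have "\<bar>abar M a e z\<bar> \<le> (\<Sum>c\<in>B. \<bar>abar M a e (y c)\<bar>)" by simp
  also have "\<dots> \<le> (\<Sum>c\<in>B. energy_norm s * (sqrt (C / \<alpha>) * energy_norm z))"
  proof (rule sum_mono)
    fix c
    have "\<bar>abar M a e (y c)\<bar> \<le> energy_norm s * energy_norm (y c)"
      by (rule abar_line_le_optimal[OF e s k yL])
    also have "\<dots> \<le> energy_norm s * (sqrt (C / \<alpha>) * energy_norm z)"
      by (intro mult_left_mono ynorm energy_norm_nonneg sU)
    finally show "\<bar>abar M a e (y c)\<bar> \<le> energy_norm s * (sqrt (C / \<alpha>) * energy_norm z)" .
  qed
  also have "\<dots> = card B * (energy_norm s * (sqrt (C / \<alpha>) * energy_norm z))" by simp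
  also have "\<dots> \<le> k * (energy_norm s * (sqrt (C / \<alpha>) * energy_norm z))"
    using B(2) energy_norm_nonneg[OF sU] energy_norm_nonneg[OF zU] bound_nonneg coercivity_pos
    by (intro mult_right_mono mult_nonneg_nonneg) auto
  finally show ?thesis by (simp add: mult_ac)
qed

section \<open>Convergence of the deflation algorithm\<close>

text \<open>
  Because the energies decrease, it suffices that they have no positive lower bound. In the
  decomposition \<open>|e\<^sub>m|\<^sup>2 = \<langle>e\<^sub>m, u - g\<rangle> + \<langle>e\<^sub>m, g\<rangle> - \<Sum>\<^sub>j\<^sub><\<^sub>m \<langle>e\<^sub>m, t\<^sub>j\<rangle>\<close> the first term
  is small when \<open>g\<close>, a finite sum of functions with values in lines, is close to \<open>u\<close>, the second
  is \<open>O(x\<^sub>m)\<close> and the last is \<open>O(x\<^sub>m \<Sum>\<^sub>j\<^sub>\<le>\<^sub>m x\<^sub>j)\<close>, which is small for suitable large \<open>m\<close>.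
\<close>

lemma deflation_energy_tendsto_zero:
  assumes u: "u \<in> L2 M UNIV" and us: "\<And>i. us i \<in> L2 M UNIV" and k: "k \<ge> 1"
    and us_0: "AE \<gamma> in M. us 0 \<gamma> = 0"
    and t: "\<And>i. t i \<in> Pi_opt M a k (\<lambda>\<gamma>. u \<gamma> - us i \<gamma>)"
    and us_Suc: "\<And>i. AE \<gamma> in M. us (Suc i) \<gamma> = us i \<gamma> + t i \<gamma>"
  shows "(\<lambda>i. abar M a (\<lambda>\<gamma>. u \<gamma> - us i \<gamma>) (\<lambda>\<gamma>. u \<gamma> - us i \<gamma>)) \<longlonglongrightarrow> 0"
proof -
  define e where "e i = (\<lambda>\<gamma>. u \<gamma> - us i \<gamma>)" for i
  define E where "E i = abar M a (e i) (e i)" for i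
  define x where "x i = energy_norm (t i)" for i
  define K where "K = k * sqrt (C / \<alpha>)"
  have K: "K \<ge> 0" unfolding K_def using bound_nonneg coercivity_pos by simp
  have e: "e i \<in> L2 M UNIV" for i unfolding e_def by (intro L2_diff u us)
  have t': "t i \<in> Pi_opt M a k (e i)" for i unfolding e_def by (rule t)
  obtain W where W: "\<And>i. W i \<in> subspaces_le k" "\<And>i. is_proj M a (W i) (e i) (t i)"
    using t' unfolding Pi_opt_def is_arg_min_def mem_Collect_eq by metis
  have tW: "t i \<in> L2 M (W i)" for i using W(2)[of i] by (simp add: is_proj_def)
  have tU: "t i \<in> L2 M UNIV" for i using tW[of i] by (simp add: L2_iff[of _ M "W i"])
  have x_nonneg: "x i \<ge> 0" for i unfolding x_def by (rule energy_norm_nonneg[OF tU])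
  have E_nonneg: "E i \<ge> 0" for i unfolding E_def by (rule abar_nonneg[OF e])
  have E_Suc: "E (Suc i) = E i - (x i)\<^sup>2" for i
  proof -
    have "AE \<gamma> in M. e (Suc i) \<gamma> = e i \<gamma> - t i \<gamma>"
      using us_Suc[of i] by eventually_elim (simp add: e_def)
    then have "E (Suc i) = abar M a (\<lambda>\<gamma>. e i \<gamma> - t i \<gamma>) (\<lambda>\<gamma>. e i \<gamma> - t i \<gamma>)"
      unfolding E_def by (intro abar_cong_AE L2_diff e tU)
    also have "\<dots> = E i - (x i)\<^sup>2"
      by (simp add: is_proj_error[OF e W(2)] E_def x_def energy_norm_square[OF tU])
    finally show ?thesis .
  qed
  have E_decseq: "decseq E" by (rule decseq_SucI) (simp add: E_Suc)
  have "summable (\<lambda>i. (x i)\<^sup>2)"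
  proof (rule summableI_nonneg_bounded)
    fix n
    have "(\<Sum>i<n. (x i)\<^sup>2) = E 0 - E n"
      by (induction n) (auto simp: E_Suc)
    then show "(\<Sum>i<n. (x i)\<^sup>2) \<le> E 0" using E_nonneg[of n] by simp
  qed simp
  note x_summable = this
  have "(\<lambda>i. sqrt ((x i)\<^sup>2)) \<longlonglongrightarrow> sqrt 0"
    by (intro tendsto_real_sqrt summable_LIMSEQ_zero x_summable)
  then have x_lim: "x \<longlonglongrightarrow> 0" using x_nonneg by simp
  have E_expand: "E m = abar M a (e m) u - (\<Sum>j<m. abar M a (e m) (t j))" for m
  proof -
    have "AE \<gamma> in M. us m \<gamma> = (\<Sum>j<m. t j \<gamma>)"
    proof (induction m)
      case 0
      show ?case using us_0 by simp
    next
      case (Suc m)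
      show ?case using Suc us_Suc[of m] by eventually_elim simp
    qed
    then have "abar M a (e m) (us m) = abar M a (e m) (\<lambda>\<gamma>. \<Sum>j<m. t j \<gamma>)"
      by (intro abar_cong_AE L2_sum e us tU) auto
    also have "\<dots> = (\<Sum>j<m. abar M a (e m) (t j))" by (intro abar_sum_right e tU)
    finally show ?thesis
      unfolding E_def using abar_diff_right[OF e u us, of m m] by (simp add: e_def)
  qed
  have small: "\<exists>m. E m < \<delta>" if "\<delta> > 0" for \<delta>
  proof -
    \<comment> \<open>The accuracy of \<open>g\<close> is chosen so that \<open>|e\<^sub>0| |u - g| \<le> \<delta> / 3\<close>; the summands \<open>1\<close> keep
      the denominators positive when \<open>E 0\<close> or \<open>C\<close> vanishes.\<close>
    define \<eta> where "\<eta> = (\<delta> / (3 * (sqrt (E 0) + 1)))\<^sup>2 / (C + 1)"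
    have d: "3 * (sqrt (E 0) + 1) > 0" using E_nonneg[of 0] by (simp add: add_nonneg_pos)
    have \<eta>: "\<eta> > 0" unfolding \<eta>_def using that bound_nonneg d
      by (intro divide_pos_pos zero_less_power) auto
    obtain Y z where Y: "finite Y" and z: "\<And>y. y \<in> Y \<Longrightarrow> z y \<in> L2 M (span {y})"
      and approx: "(\<integral>\<gamma>. (norm (u \<gamma> - (\<Sum>y\<in>Y. z y \<gamma>)))\<^sup>2 \<partial>M) < \<eta>"
      using L2_approx_by_lines[OF u \<eta>] by blast
    define g where "g = (\<lambda>\<gamma>. \<Sum>y\<in>Y. z y \<gamma>)"
    have zU: "z y \<in> L2 M UNIV" if "y \<in> Y" for y
      using z[OF that] by (simp add: L2_iff[of _ M "span {y}"])
    have g: "g \<in> L2 M UNIV" unfolding g_def by (intro L2_sum zU)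
    define r where "r = (\<lambda>\<gamma>. u \<gamma> - g \<gamma>)"
    have r: "r \<in> L2 M UNIV" unfolding r_def by (intro L2_diff u g)
    have "abar M a r r \<le> C * (\<integral>\<gamma>. (norm (r \<gamma>))\<^sup>2 \<partial>M)" by (rule abar_le_L2_norm[OF r])
    also have "\<dots> \<le> (C + 1) * \<eta>"
      using approx bound_nonneg by (intro mult_mono) (auto simp: r_def g_def)
    also have "\<dots> = (\<delta> / (3 * (sqrt (E 0) + 1)))\<^sup>2"
      using bound_nonneg by (simp add: \<eta>_def)
    finally have "energy_norm r \<le> \<delta> / (3 * (sqrt (E 0) + 1))"
      unfolding energy_norm_def using that d by (intro real_le_lsqrt) auto
    then have r_small: "(sqrt (E 0) + 1) * energy_norm r \<le> \<delta> / 3"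
      using d by (simp add: field_simps)
    define G where "G = (\<Sum>y\<in>Y. energy_norm (z y))"
    have er: "\<bar>abar M a (e m) r\<bar> \<le> \<delta> / 3" for m
    proof -
      have "E m \<le> E 0" using E_decseq by (simp add: decseq_def)
      then have "energy_norm (e m) \<le> sqrt (E 0) + 1"
        unfolding energy_norm_def E_def[symmetric] by (smt (verit) real_sqrt_le_mono)
      then have "energy_norm (e m) * energy_norm r \<le> (sqrt (E 0) + 1) * energy_norm r"
        by (intro mult_right_mono energy_norm_nonneg[OF r])
      with abar_Cauchy_Schwarz[OF e r, of m] r_small show ?thesis by linarith
    qed
    have eg: "\<bar>abar M a (e m) g\<bar> \<le> x m * G" for m
    proof -
      have "abar M a (e m) g = (\<Sum>y\<in>Y. abar M a (e m) (z y))"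
        unfolding g_def by (intro abar_sum_right e zU)
      also have "\<bar>\<dots>\<bar> \<le> (\<Sum>y\<in>Y. \<bar>abar M a (e m) (z y)\<bar>)" by simp
      also have "\<dots> \<le> (\<Sum>y\<in>Y. x m * energy_norm (z y))"
        unfolding x_def by (intro sum_mono abar_line_le_optimal[OF e t' k z])
      finally show ?thesis by (simp add: G_def sum_distrib_left)
    qed
    have et: "\<bar>\<Sum>j<m. abar M a (e m) (t j)\<bar> \<le> K * (x m * (\<Sum>j\<le>m. x j))" for m
    proof -
      have "\<bar>\<Sum>j<m. abar M a (e m) (t j)\<bar> \<le> (\<Sum>j<m. \<bar>abar M a (e m) (t j)\<bar>)" by simp
      also have "\<dots> \<le> (\<Sum>j<m. K * (x m * x j))"
        unfolding x_def K_def by (intro sum_mono abar_subspace_le_optimal[OF e t' k W(1) tW])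
      also have "\<dots> \<le> (\<Sum>j\<le>m. K * (x m * x j))"
        using K x_nonneg by (intro sum_mono2) auto
      finally show ?thesis by (simp add: sum_distrib_left)
    qed
    have "(\<lambda>m. x m * G) \<longlonglongrightarrow> 0 * G" by (intro tendsto_intros x_lim)
    then have "\<forall>\<^sub>F m in sequentially. x m * G < \<delta> / 3"
      using that by (intro order_tendstoD) auto
    then obtain N where N: "\<And>m. m \<ge> N \<Longrightarrow> x m * G < \<delta> / 3"
      by (auto simp: eventually_sequentially)
    have "\<delta> / (3 * (K + 1)) > 0" using that K by (intro divide_pos_pos) auto
    then obtain m where m: "m \<ge> N" "x m * (\<Sum>j\<le>m. x j) < \<delta> / (3 * (K + 1))"
      using square_summable_times_partial_sum_small[OF x_nonneg x_summable] by blast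
    have "0 \<le> x m * (\<Sum>j\<le>m. x j)" by (intro mult_nonneg_nonneg sum_nonneg x_nonneg)
    then have "K * (x m * (\<Sum>j\<le>m. x j)) \<le> (K + 1) * (x m * (\<Sum>j\<le>m. x j))"
      by (intro mult_right_mono) auto
    also have "\<dots> < \<delta> / 3" using m(2) K by (simp add: field_simps)
    finally have "K * (x m * (\<Sum>j\<le>m. x j)) < \<delta> / 3" .
    moreover have "abar M a (e m) u = abar M a (e m) r + abar M a (e m) g"
      using abar_diff_right[OF e u g, of m] by (simp add: r_def)
    ultimately have "E m < \<delta>"
      using E_expand[of m] er[of m] eg[of m] et[of m] N[OF m(1)] by linarith
    then show ?thesis by blast
  qed
  have "E \<longlonglongrightarrow> 0"
  proof (rule LIMSEQ_I)
    fix \<delta> :: real assume "\<delta> > 0"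
    then obtain m where m: "E m < \<delta>" using small by blast
    have "norm (E n - 0) < \<delta>" if "n \<ge> m" for n
      using E_decseq that m E_nonneg[of n] by (auto simp: decseq_def intro: le_less_trans)
    then show "\<exists>m. \<forall>n\<ge>m. norm (E n - 0) < \<delta>" by blast
  qed
  then show ?thesis by (simp add: E_def[abs_def] e_def)
qed

end

theorem theorem5p2:
  fixes M :: "'g measure"
    and a :: "'g \<Rightarrow> 'h::{real_inner, banach, second_countable_topology} \<Rightarrow>\<^sub>L 'h \<Rightarrow>\<^sub>L real"
    and \<alpha> :: real
    and f :: "'g \<Rightarrow> 'h \<Rightarrow>\<^sub>L real"
    and u :: "'g \<Rightarrow> 'h"
    and k :: nat
    and us s :: "nat \<Rightarrow> 'g \<Rightarrow> 'h"
  assumes "sigma_finite_measure M"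
    and "a \<in> Linf M sym_forms"
    and "\<alpha> > 0"
    and "AE \<gamma> in M. \<forall>v. \<alpha> * (norm v)\<^sup>2 \<le> blinfun_apply (blinfun_apply (a \<gamma>) v) v"
    and "f \<in> L2 M UNIV"
    and "u \<in> L2 M UNIV"
    and "\<And>v. v \<in> L2 M UNIV \<Longrightarrow> abar M a u v = (\<integral>\<gamma>. blinfun_apply (f \<gamma>) (v \<gamma>) \<partial>M)"
    and "k \<ge> 1"
    and "\<And>i. us i \<in> L2 M UNIV"
    and "AE \<gamma> in M. us 0 \<gamma> = 0"
    and "\<And>i. i \<ge> 1 \<Longrightarrow> s i \<in> Pi_opt M a k (\<lambda>\<gamma>. u \<gamma> - us (i - 1) \<gamma>)"
    and "\<And>i. i \<ge> 1 \<Longrightarrow> AE \<gamma> in M. us i \<gamma> = us (i - 1) \<gamma> + s i \<gamma>"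
  shows "(\<lambda>i. L2_norm M (\<lambda>\<gamma>. us i \<gamma> - u \<gamma>)) \<longlonglongrightarrow> 0"
proof -
  obtain C0 where C0: "AE \<gamma> in M. norm (a \<gamma>) \<le> C0"
    using assms(2) unfolding Linf_def by blast
  interpret parametrized_form M a \<alpha> "max C0 0"
  proof
    show "AE \<gamma> in M. norm (a \<gamma>) \<le> max C0 0" using C0 by eventually_elim simp
  qed (use assms(2-4) in \<open>auto simp: Linf_def\<close>)
  define E where "E i = abar M a (\<lambda>\<gamma>. u \<gamma> - us i \<gamma>) (\<lambda>\<gamma>. u \<gamma> - us i \<gamma>)" for i
  have "E \<longlonglongrightarrow> 0"
    unfolding E_def
  proof (rule deflation_energy_tendsto_zero[where t = "\<lambda>i. s (Suc i)"])
    show "s (Suc i) \<in> Pi_opt M a k (\<lambda>\<gamma>. u \<gamma> - us i \<gamma>)" for i using assms(11)[of "Suc i"] by simp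
    show "AE \<gamma> in M. us (Suc i) \<gamma> = us i \<gamma> + s (Suc i) \<gamma>" for i using assms(12)[of "Suc i"] by simp
  qed (use assms(6,8,9,10) in auto)
  then have lim: "(\<lambda>i. sqrt (E i / \<alpha>)) \<longlonglongrightarrow> 0"
    using tendsto_real_sqrt[OF tendsto_divide[OF _ tendsto_const[of \<alpha>]], of E 0] \<open>\<alpha> > 0\<close> by simp
  have "L2_norm M (\<lambda>\<gamma>. us i \<gamma> - u \<gamma>) \<le> sqrt (E i / \<alpha>)" for i
    using abar_ge_L2_norm[OF L2_diff[OF assms(6,9), of i]] \<open>\<alpha> > 0\<close>
    unfolding L2_norm_def E_def
    by (intro real_sqrt_le_mono) (simp add: norm_minus_commute field_simps)
  then show ?thesis
    by (intro tendsto_sandwich[OF _ _ tendsto_const lim]) (auto simp: L2_norm_def)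
qed

end
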